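(* Let $C_{\mathsf{MSE}}>0$. There exist constants $C_{\mathsf{high}}>0$, $c_{\mathrm{high}}>0$ and $N_0$, depending only on $C_{\mathsf{MSE}}$, such that for all $d\ge1$, all $n\ge N_0$, every measurable $f\colon(\mathbb R^d)^n\to\mathbb R^d$ that is $(C_{\mathsf{MSE}},\frac dn)$-uniformly MSE-accurate for $\{\mathcal N(\mu,\mathbb I_d)\}_{\mu\in\mathbb R^d}$, and every $\eta\in(0,\frac1{10})$ with $\lfloor\eta n\rfloor\ge C_{\mathsf{high}}\log n$, we have \[\sup_{\mu\in\mathbb R^d}\mathsf{ES}_{\eta,2}(f;\mu)\ge c_{\mathrm{high}}\,\eta.\]
   Context: For datasets $x,x'\in(\mathbb R^d)^n$, $d_H(x,x')=\#\{i\in[n]: x_i\neq x_i'\}$. For $f\colon(\mathbb R^d)^n\to\mathbb R^d$ and $\eta\in(0,1)$, $S^f_\eta(X)=\sup_{X'\colon d_H(X,X')\le\lfloor\eta n\rfloor}\|f(X)-f(X')\|_2$, and for $q\in\{1,2\}$, $\mathsf{ES}_{\eta,q}(f;\mu)=\big(\mathbb E_{X\sim\mathcal N(\mu,\mathbb I_d)^{\otimes n}}[S^f_\eta(X)^q]\big)^{1/q}$. $f$ is $(C_{\mathsf{MSE}},\frac dn)$-uniformly MSE-accurate if $\sup_{\mu\in\mathbb R^d}\mathbb E_{X\sim\mathcal N(\mu,\mathbb I_d)^{\otimes n}}\|f(X)-\mu\|_2^2\le C_{\mathsf{MSE}}\frac dn$. *)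

theory Defs
  imports "HOL-Probability.Probability"
begin

definition vecs :: "nat \<Rightarrow> (nat \<Rightarrow> real) set" where
  "vecs d = PiE {..<d} (\<lambda>_. UNIV)"

definition datasets :: "nat \<Rightarrow> nat \<Rightarrow> (nat \<Rightarrow> nat \<Rightarrow> real) set" where
  "datasets d n = PiE {..<n} (\<lambda>_. vecs d)"

definition dist_d :: "nat \<Rightarrow> (nat \<Rightarrow> real) \<Rightarrow> (nat \<Rightarrow> real) \<Rightarrow> real" where
  "dist_d d x y = sqrt (\<Sum>i<d. (x i - y i)^2)"

definition hamming :: "nat \<Rightarrow> (nat \<Rightarrow> nat \<Rightarrow> real) \<Rightarrow> (nat \<Rightarrow> nat \<Rightarrow> real) \<Rightarrow> nat" where
  "hamming n X X' = card {i \<in> {..<n}. X i \<noteq> X' i}"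

definition data_space :: "nat \<Rightarrow> nat \<Rightarrow> (nat \<Rightarrow> nat \<Rightarrow> real) measure" where
  "data_space d n = PiM {..<n} (\<lambda>_. PiM {..<d} (\<lambda>_. lborel))"

definition gauss_data :: "nat \<Rightarrow> nat \<Rightarrow> (nat \<Rightarrow> real) \<Rightarrow> (nat \<Rightarrow> nat \<Rightarrow> real) measure" where
  "gauss_data d n \<mu> = PiM {..<n} (\<lambda>_. PiM {..<d} (\<lambda>i. density lborel (normal_density (\<mu> i) 1)))"

definition sens :: "nat \<Rightarrow> nat \<Rightarrow> ((nat \<Rightarrow> nat \<Rightarrow> real) \<Rightarrow> (nat \<Rightarrow> real)) \<Rightarrow> real
    \<Rightarrow> (nat \<Rightarrow> nat \<Rightarrow> real) \<Rightarrow> ennreal" where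
  "sens d n f \<eta> X = (SUP X' \<in> {X' \<in> datasets d n. hamming n X X' \<le> nat \<lfloor>\<eta> * real n\<rfloor>}.
      ennreal (dist_d d (f X) (f X')))"

definition ES2 :: "nat \<Rightarrow> nat \<Rightarrow> ((nat \<Rightarrow> nat \<Rightarrow> real) \<Rightarrow> (nat \<Rightarrow> real)) \<Rightarrow> real
    \<Rightarrow> (nat \<Rightarrow> real) \<Rightarrow> ennreal" where
  "ES2 d n f \<eta> \<mu> =
     (let E = (\<integral>\<^sup>+ X. (sens d n f \<eta> X)^2 \<partial>(gauss_data d n \<mu>))
      in if E = \<infinity> then \<infinity> else ennreal (sqrt (enn2real E)))"

definition mse_accurate :: "real \<Rightarrow> nat \<Rightarrow> nat \<Rightarrow> ((nat \<Rightarrow> nat \<Rightarrow> real) \<Rightarrow> (nat \<Rightarrow> real)) \<Rightarrow> bool" where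
  "mse_accurate C d n f \<longleftrightarrow>
     (\<forall>\<mu> \<in> vecs d. (\<integral>\<^sup>+ X. ennreal ((dist_d d (f X) \<mu>)^2) \<partial>(gauss_data d n \<mu>))
        \<le> ennreal (C * real d / real n))"

definition meas_estimator :: "nat \<Rightarrow> nat \<Rightarrow> ((nat \<Rightarrow> nat \<Rightarrow> real) \<Rightarrow> (nat \<Rightarrow> real)) \<Rightarrow> bool" where
  "meas_estimator d n f \<longleftrightarrow> (\<forall>i<d. (\<lambda>X. f X i) \<in> borel_measurable (data_space d n))"

end

theory Submission
  imports Defs
begin

text \<open>Suppose the sensitivity is below \<open>c \<eta>\<close> at every mean. Maximally coupling the samples of
  \<open>N(\<mu>, I)\<close> and \<open>N(\<mu> + \<delta> e\<^sub>j, I)\<close> for \<open>\<delta> = \<eta> / 32\<close> gives two datasets which, by a Chernoff bound, differ in at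
  most \<open>\<eta> n\<close> places except with probability \<open>n\<^sup>-\<^sup>3\<close>. So the expectation of the \<open>j\<close>-th coordinate of \<open>f\<close> moves by
  at most \<open>c \<eta>\<close> plus a negligible term, which is less than \<open>\<delta> / 2\<close>. Along a line of means of length
  a large multiple of \<open>n\<^sup>-\<^sup>1\<^sup>/\<^sup>2\<close> the bias therefore accumulates beyond the accuracy of \<open>f\<close>. To make
  this independent of the dimension, average the error over a cubic grid of means and over the
  coordinates: some direction \<open>j\<close> and some grid line parallel to \<open>e\<^sub>j\<close> have average squared
  error in the \<open>j\<close>-th coordinate at most \<open>C / n\<close>.\<close>

subsection \<open>Randomised maps between finite product spaces\<close>

text \<open>Tonelli, then the product rule for independent coordinates, first in the noise and then
  in the data. It serves with indicator factors to identify a law on boxes, with all factors but one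
  equal to 1 to marginalise, and with exponential factors for a Chernoff bound.\<close>

lemma nn_integral_pair_PiM_prod:
  assumes "finite I"
    and M: "\<And>i. prob_space (M i)" and U: "\<And>i. prob_space (U i)"
    and h: "\<And>i. i \<in> I \<Longrightarrow> h i \<in> borel_measurable (M i \<Otimes>\<^sub>M U i)"
  shows "(\<integral>\<^sup>+ z. (\<Prod>i\<in>I. h i (fst z i, snd z i)) \<partial>(PiM I M \<Otimes>\<^sub>M PiM I U))
       = (\<Prod>i\<in>I. \<integral>\<^sup>+ z. h i z \<partial>(M i \<Otimes>\<^sub>M U i))"
proof -
  interpret M: product_prob_space M using M by (rule product_prob_spaceI)
  interpret U: product_prob_space U using U by (rule product_prob_spaceI)
  have PU: "sigma_finite_measure (PiM I U)"
    by (intro prob_space_imp_sigma_finite prob_space_PiM U)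
  have comp: "(\<lambda>z. (fst z i, snd z i)) \<in> PiM I M \<Otimes>\<^sub>M PiM I U \<rightarrow>\<^sub>M M i \<Otimes>\<^sub>M U i" if "i \<in> I" for i
    using that by measurable
  have "(\<lambda>z. \<Prod>i\<in>I. h i (fst z i, snd z i)) \<in> borel_measurable (PiM I M \<Otimes>\<^sub>M PiM I U)"
    by (intro borel_measurable_prod_ennreal measurable_compose[OF comp h])
  from sigma_finite_measure.nn_integral_fst[OF PU this]
  have "(\<integral>\<^sup>+ z. (\<Prod>i\<in>I. h i (fst z i, snd z i)) \<partial>(PiM I M \<Otimes>\<^sub>M PiM I U))
      = (\<integral>\<^sup>+ x. \<integral>\<^sup>+ u. (\<Prod>i\<in>I. h i (x i, u i)) \<partial>PiM I U \<partial>PiM I M)"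
    by simp
  also have "\<dots> = (\<integral>\<^sup>+ x. (\<Prod>i\<in>I. \<integral>\<^sup>+ u. h i (x i, u) \<partial>U i) \<partial>PiM I M)"
  proof (rule nn_integral_cong)
    fix x assume x: "x \<in> space (PiM I M)"
    have "(\<lambda>u. h i (x i, u)) \<in> borel_measurable (U i)" if "i \<in> I" for i
      using x that by (intro measurable_compose[OF measurable_Pair1' h]) (auto simp: space_PiM)
    then show "(\<integral>\<^sup>+ u. (\<Prod>i\<in>I. h i (x i, u i)) \<partial>PiM I U) = (\<Prod>i\<in>I. \<integral>\<^sup>+ u. h i (x i, u) \<partial>U i)"
      using \<open>finite I\<close> by (intro U.product_nn_integral_prod)
  qed
  also have "\<dots> = (\<Prod>i\<in>I. \<integral>\<^sup>+ x. \<integral>\<^sup>+ u. h i (x, u) \<partial>U i \<partial>M i)"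
    using \<open>finite I\<close> h
    by (intro M.product_nn_integral_prod sigma_finite_measure.borel_measurable_nn_integral_fst)
       (auto intro: prob_space_imp_sigma_finite U)
  also have "\<dots> = (\<Prod>i\<in>I. \<integral>\<^sup>+ z. h i z \<partial>(M i \<Otimes>\<^sub>M U i))"
    by (intro prod.cong refl sigma_finite_measure.nn_integral_fst h)
       (auto intro: prob_space_imp_sigma_finite U)
  finally show ?thesis .
qed

text \<open>A product of Markov kernels in explicit form: each coordinate is transformed with its
  own independent noise, taken from the second component of \<open>z\<close>. The construction can
  be nested, over the entries of a row and over the rows of a dataset.\<close>

definition rand_map :: "'i set \<Rightarrow> ('i \<Rightarrow> 'a \<times> 'b \<Rightarrow> 'c) \<Rightarrow> ('i \<Rightarrow> 'a) \<times> ('i \<Rightarrow> 'b) \<Rightarrow> 'i \<Rightarrow> 'c" where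
  "rand_map I t z = (\<lambda>i\<in>I. t i (fst z i, snd z i))"

lemma measurable_rand_map:
  assumes "\<And>i. i \<in> I \<Longrightarrow> t i \<in> M i \<Otimes>\<^sub>M U i \<rightarrow>\<^sub>M N i"
  shows "rand_map I t \<in> PiM I M \<Otimes>\<^sub>M PiM I U \<rightarrow>\<^sub>M PiM I N"
proof -
  have "(\<lambda>z. t i (fst z i, snd z i)) \<in> PiM I M \<Otimes>\<^sub>M PiM I U \<rightarrow>\<^sub>M N i" if "i \<in> I" for i
    by (rule measurable_compose[OF _ assms[OF that]]) (use that in measurable)
  then show ?thesis
    unfolding rand_map_def by (intro measurable_restrict)
qed

text \<open>A product measure is determined by its values on boxes, and the indicator of a box is a
  product of coordinate indicators, so the integral factorises.\<close>

lemma distr_rand_map: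
  assumes "finite I"
    and M: "\<And>i. prob_space (M i)" and U: "\<And>i. prob_space (U i)"
    and t: "\<And>i. t i \<in> M i \<Otimes>\<^sub>M U i \<rightarrow>\<^sub>M N i"
  shows "distr (PiM I M \<Otimes>\<^sub>M PiM I U) (PiM I N) (rand_map I t)
       = PiM I (\<lambda>i. distr (M i \<Otimes>\<^sub>M U i) (N i) (t i))" (is "?D = PiM I ?Q")
proof -
  have "prob_space (?Q i)" for i
    by (intro prob_space.prob_space_distr t prob_space_pair M U)
  then interpret Q: product_prob_space ?Q by (rule product_prob_spaceI)
  have rm: "rand_map I t \<in> PiM I M \<Otimes>\<^sub>M PiM I U \<rightarrow>\<^sub>M PiM I N"
    by (rule measurable_rand_map) (rule t)
  show ?thesis
  proof (rule Q.PiM_eqI)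
    show "sets ?D = sets (PiM I ?Q)" by (simp cong: sets_PiM_cong)
    fix A assume "\<And>i. i \<in> I \<Longrightarrow> A i \<in> sets (?Q i)"
    then have A: "\<And>i. i \<in> I \<Longrightarrow> A i \<in> sets (N i)" by simp
    have "emeasure ?D (Pi\<^sub>E I A) = (\<integral>\<^sup>+ z. indicator (Pi\<^sub>E I A) (rand_map I t z) \<partial>(PiM I M \<Otimes>\<^sub>M PiM I U))"
      using nn_integral_distr[OF rm, of "indicator (Pi\<^sub>E I A)"] A \<open>finite I\<close>
      by (simp add: sets_PiM_I_finite)
    also have "\<dots> = (\<integral>\<^sup>+ z. (\<Prod>i\<in>I. indicator (A i) (t i (fst z i, snd z i))) \<partial>(PiM I M \<Otimes>\<^sub>M PiM I U))"
    proof (rule nn_integral_cong)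
      fix z
      \<comment> \<open>\<open>rand_map\<close> returns extensional functions, so membership in the
        box is decided by the coordinates in \<open>I\<close>.\<close>
      show "indicator (Pi\<^sub>E I A) (rand_map I t z) = (\<Prod>i\<in>I. indicator (A i) (t i (fst z i, snd z i)) :: ennreal)"
        using \<open>finite I\<close> by (auto simp: rand_map_def indicator_def PiE_iff Ball_def)
    qed
    also have "\<dots> = (\<Prod>i\<in>I. \<integral>\<^sup>+ z. indicator (A i) (t i z) \<partial>(M i \<Otimes>\<^sub>M U i))"
      by (rule nn_integral_pair_PiM_prod[where M = M and U = U and h = "\<lambda>i z. indicator (A i) (t i z)",
            OF \<open>finite I\<close> M U])
         (auto intro!: measurable_compose[OF t] borel_measurable_indicator A)
    also have "\<dots> = (\<Prod>i\<in>I. emeasure (?Q i) (A i))"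
      using A t by (intro prod.cong refl, subst nn_integral_distr[symmetric]) auto
    finally show "emeasure ?D (Pi\<^sub>E I A) = (\<Prod>i\<in>I. emeasure (?Q i) (A i))" .
  qed fact
qed

subsection \<open>Coupling two unit-variance Gaussians\<close>

abbreviation gauss :: "real \<Rightarrow> real measure" where
  "gauss a \<equiv> density lborel (normal_density a 1)"

definition unif :: "real measure" where
  "unif = uniform_measure lborel {0..1}"

text \<open>The rejection event of the maximal coupling. With \<open>p\<close> and \<open>q\<close>
  the densities with means \<open>a\<close> and \<open>a + \<delta>\<close> and \<open>u\<close>
  uniform, \<open>x\<close> is kept with probability \<open>min 1 (q x / p x)\<close>; the
  inequality is cleared of the quotient.\<close>

definition moved :: "real \<Rightarrow> real \<Rightarrow> (real \<times> real) set" where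
  "moved a \<delta> = {(x, u). normal_density (a + \<delta>) 1 x < u * normal_density a 1 x}"

text \<open>A rejected point is reflected in the midpoint \<open>a + \<delta> / 2\<close> of the two
  means, which exchanges the two densities.\<close>

definition gauss_shift :: "real \<Rightarrow> real \<Rightarrow> real \<times> real \<Rightarrow> real" where
  "gauss_shift a \<delta> z = (if z \<in> moved a \<delta> then 2 * a + \<delta> - fst z else fst z)"

lemma prob_space_gauss: "prob_space (gauss a)"
  by (rule prob_space_normal_density) simp

lemma prob_space_unif: "prob_space unif"
  unfolding unif_def by (rule prob_space_uniform_measure) auto

lemma sets_unif [measurable_cong, simp]: "sets unif = sets borel"
  by (simp add: unif_def)

lemma space_unif [simp]: "space unif = UNIV"
  by (simp add: unif_def)

lemma moved_measurable [measurable]: "moved a \<delta> \<in> sets (borel \<Otimes>\<^sub>M borel)"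
proof -
  have "moved a \<delta> = {z \<in> space (borel \<Otimes>\<^sub>M borel).
      normal_density (a + \<delta>) 1 (fst z) < snd z * normal_density a 1 (fst z)}"
    by (auto simp: moved_def space_pair_measure)
  also have "\<dots> \<in> sets (borel \<Otimes>\<^sub>M borel)" by measurable
  finally show ?thesis .
qed

lemma gauss_shift_measurable [measurable]: "gauss_shift a \<delta> \<in> borel_measurable (borel \<Otimes>\<^sub>M borel)"
  unfolding gauss_shift_def[abs_def] by measurable

lemma emeasure_unif_greaterThan:
  assumes "0 \<le> r" shows "emeasure unif {r<..} = ennreal (1 - min 1 r)"
proof -
  have "{0..1} \<inter> {r<..} = {r<..1::real}" using assms by auto
  then show ?thesis
    by (cases "r \<le> 1") (simp_all add: unif_def min_def divide_ennreal_def)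
qed

lemma emeasure_unif_atMost:
  assumes "0 \<le> r" shows "emeasure unif {..r} = ennreal (min 1 r)"
proof -
  have "{0..1} \<inter> {..r} = {0..min 1 r}" using assms by auto
  then show ?thesis using assms by (simp add: unif_def divide_ennreal_def)
qed

text \<open>Integrating out \<open>u\<close> splits \<open>p\<close> into the overlap
  \<open>min p q\<close>, which is kept, and the excess, which is rejected. With general
  \<open>h\<close> and \<open>k\<close>, one formula yields both the law of the coupled point and
  the mass of \<open>moved\<close>.\<close>

lemma nn_integral_gauss_unif:
  fixes h k :: "real \<Rightarrow> ennreal" and a \<delta> :: real
  assumes [measurable]: "h \<in> borel_measurable borel" "k \<in> borel_measurable borel"
  defines "p \<equiv> normal_density a 1" and "q \<equiv> normal_density (a + \<delta>) 1"
  shows "(\<integral>\<^sup>+ z. (if z \<in> moved a \<delta> then k (fst z) else h (fst z)) \<partial>(gauss a \<Otimes>\<^sub>M unif))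
    = (\<integral>\<^sup>+ x. ennreal (min (p x) (q x)) * h x + ennreal (p x - min (p x) (q x)) * k x \<partial>lborel)"
proof -
  interpret U: prob_space unif by (rule prob_space_unif)
  have p: "p x > 0" and q: "q x > 0" for x by (simp_all add: p_def q_def normal_density_pos)
  have [measurable]: "p \<in> borel_measurable borel" by (simp add: p_def)
  have "(\<integral>\<^sup>+ z. (if z \<in> moved a \<delta> then k (fst z) else h (fst z)) \<partial>(gauss a \<Otimes>\<^sub>M unif))
      = (\<integral>\<^sup>+ x. \<integral>\<^sup>+ u. (if (x, u) \<in> moved a \<delta> then k x else h x) \<partial>unif \<partial>gauss a)"
    by (subst U.nn_integral_fst[symmetric]) (simp_all cong: if_cong)
  also have "\<dots> = (\<integral>\<^sup>+ x. h x * ennreal (min 1 (q x / p x)) + k x * ennreal (1 - min 1 (q x / p x)) \<partial>gauss a)"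
  proof (rule nn_integral_cong)
    fix x
    have "(\<integral>\<^sup>+ u. (if (x, u) \<in> moved a \<delta> then k x else h x) \<partial>unif)
      = (\<integral>\<^sup>+ u. h x * indicator {..q x / p x} u + k x * indicator {q x / p x<..} u \<partial>unif)"
      using p[of x]
      by (intro nn_integral_cong) (auto simp: moved_def field_simps p_def q_def indicator_def)
    also have "\<dots> = h x * ennreal (min 1 (q x / p x)) + k x * ennreal (1 - min 1 (q x / p x))"
      using p[of x] q[of x]
      by (simp add: nn_integral_add nn_integral_cmult_indicator emeasure_unif_atMost emeasure_unif_greaterThan)
    finally show "(\<integral>\<^sup>+ u. (if (x, u) \<in> moved a \<delta> then k x else h x) \<partial>unif) = \<dots>" .
  qed
  also have "\<dots> = (\<integral>\<^sup>+ x. ennreal (p x) * (h x * ennreal (min 1 (q x / p x)) + k x * ennreal (1 - min 1 (q x / p x))) \<partial>lborel)"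
    by (subst nn_integral_density) (simp_all add: p_def q_def)
  also have "\<dots> = (\<integral>\<^sup>+ x. ennreal (min (p x) (q x)) * h x + ennreal (p x - min (p x) (q x)) * k x \<partial>lborel)"
  proof (rule nn_integral_cong)
    fix x
    have *: "p x * min 1 (q x / p x) = min (p x) (q x)"
      using p[of x] by (auto simp: min_def field_simps)
    have "ennreal (p x) * ennreal (min 1 (q x / p x)) = ennreal (min (p x) (q x))"
      using p[of x] q[of x] by (simp add: ennreal_mult[symmetric] *)
    moreover have "ennreal (p x) * ennreal (1 - min 1 (q x / p x)) = ennreal (p x - min (p x) (q x))"
      using p[of x] q[of x] by (simp add: ennreal_mult[symmetric] right_diff_distrib *)
    ultimately show "ennreal (p x) * (h x * ennreal (min 1 (q x / p x)) + k x * ennreal (1 - min 1 (q x / p x)))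
      = ennreal (min (p x) (q x)) * h x + ennreal (p x - min (p x) (q x)) * k x"
      by (simp add: distrib_left mult.assoc[symmetric] mult.commute[of "h x"] mult.commute[of "k x"])
  qed
  finally show ?thesis .
qed

text \<open>The overlap \<open>m\<close> stays in place. The reflection swaps \<open>p\<close> and
  \<open>q\<close> and preserves \<open>m\<close>, so it carries the excess \<open>p - m\<close> to
  \<open>q - m\<close>, and the two pieces add up to \<open>q\<close>.\<close>

lemma distr_gauss_shift: "distr (gauss a \<Otimes>\<^sub>M unif) borel (gauss_shift a \<delta>) = gauss (a + \<delta>)"
proof (rule measure_eqI)
  fix A assume "A \<in> sets (distr (gauss a \<Otimes>\<^sub>M unif) borel (gauss_shift a \<delta>))"
  then have [measurable]: "A \<in> sets borel" by simp
  define p q where "p = normal_density a 1" and "q = normal_density (a + \<delta>) 1"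
  define m where "m x = min (p x) (q x)" for x
  have [measurable]: "p \<in> borel_measurable borel" "q \<in> borel_measurable borel" "m \<in> borel_measurable borel"
    by (simp_all add: p_def q_def m_def[abs_def])
  have pos: "p x \<ge> 0" "q x \<ge> 0" "m x \<ge> 0" "m x \<le> p x" "m x \<le> q x" for x
    by (simp_all add: p_def q_def m_def)
  have refl1: "p (2 * a + \<delta> - x) = q x" for x
    unfolding p_def q_def normal_density_def by (simp add: power2_eq_square algebra_simps)
  have refl2: "q (2 * a + \<delta> - x) = p x" for x
    unfolding p_def q_def normal_density_def by (simp add: power2_eq_square algebra_simps)
  have refl3: "m (2 * a + \<delta> - x) = m x" for x
    unfolding m_def refl1 refl2 by (simp add: min.commute)
  have "emeasure (distr (gauss a \<Otimes>\<^sub>M unif) borel (gauss_shift a \<delta>)) A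
     = (\<integral>\<^sup>+ z. indicator A (gauss_shift a \<delta> z) \<partial>(gauss a \<Otimes>\<^sub>M unif))"
    using nn_integral_distr[of "gauss_shift a \<delta>" "gauss a \<Otimes>\<^sub>M unif" borel "indicator A"] by simp
  also have "\<dots> = (\<integral>\<^sup>+ z. (if z \<in> moved a \<delta> then indicator A (2 * a + \<delta> - fst z) else indicator A (fst z)) \<partial>(gauss a \<Otimes>\<^sub>M unif))"
    by (intro nn_integral_cong) (simp add: gauss_shift_def)
  also have "\<dots> = (\<integral>\<^sup>+ x. ennreal (m x) * indicator A x + ennreal (p x - m x) * indicator A (2 * a + \<delta> - x) \<partial>lborel)"
    using nn_integral_gauss_unif[of "indicator A" "\<lambda>x. indicator A (2 * a + \<delta> - x)" a \<delta>]
    by (simp add: p_def q_def m_def)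
  also have "\<dots> = (\<integral>\<^sup>+ x. ennreal (m x) * indicator A x \<partial>lborel)
                + (\<integral>\<^sup>+ x. ennreal (p x - m x) * indicator A (2 * a + \<delta> - x) \<partial>lborel)"
    by (rule nn_integral_add) simp_all
  also have "(\<integral>\<^sup>+ x. ennreal (p x - m x) * indicator A (2 * a + \<delta> - x) \<partial>lborel)
       = (\<integral>\<^sup>+ x. ennreal (q x - m x) * indicator A x \<partial>lborel)"
    by (subst nn_integral_real_affine[where c = "-1" and t = "2 * a + \<delta>"]) (simp_all add: refl1 refl3)
  also have "(\<integral>\<^sup>+ x. ennreal (m x) * indicator A x \<partial>lborel) + \<dots>
      = (\<integral>\<^sup>+ x. ennreal (m x) * indicator A x + ennreal (q x - m x) * indicator A x \<partial>lborel)"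
    by (rule nn_integral_add[symmetric]) simp_all
  also have "\<dots> = (\<integral>\<^sup>+ x. ennreal (q x) * indicator A x \<partial>lborel)"
    using pos by (intro nn_integral_cong) (simp add: distrib_right[symmetric] ennreal_plus[symmetric] del: ennreal_plus)
  also have "\<dots> = emeasure (gauss (a + \<delta>)) A"
    by (simp add: emeasure_density q_def)
  finally show "emeasure (distr (gauss a \<Otimes>\<^sub>M unif) borel (gauss_shift a \<delta>)) A = emeasure (gauss (a + \<delta>)) A" .
qed simp

text \<open>The mass is the total variation distance of the two Gaussians. Any bound linear in
  \<delta> suffices, so the exponential in \<open>q / p\<close> is replaced by its tangent and the
  linear term \<open>\<delta> * (x - a)\<close> is traded for a square. The second moment then gives
  \<open>\<delta>\<^sup>2 / 2 + \<delta>\<close>.\<close>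

lemma emeasure_moved_le:
  assumes \<delta>: "0 \<le> \<delta>" "\<delta> \<le> 1"
  shows "emeasure (gauss a \<Otimes>\<^sub>M unif) (moved a \<delta>) \<le> ennreal (2 * \<delta>)"
proof -
  define p q where "p = normal_density a 1" and "q = normal_density (a + \<delta>) 1"
  define b where "b x = \<delta>\<^sup>2 / 2 + \<delta> / 2 * (1 + (x - a)\<^sup>2)" for x
  have bound: "p x - min (p x) (q x) \<le> p x * b x" for x
  proof -
    have p: "p x > 0" by (simp add: p_def normal_density_pos)
    have "q x = p x * exp (\<delta> * (x - a) - \<delta>\<^sup>2 / 2)"
      unfolding p_def q_def normal_density_def
      by (simp add: exp_add[symmetric] power2_eq_square field_simps)
    moreover have "exp (\<delta> * (x - a) - \<delta>\<^sup>2 / 2) \<ge> 1 + (\<delta> * (x - a) - \<delta>\<^sup>2 / 2)"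
      by (rule exp_ge_add_one_self)
    moreover have "\<delta> * (x - a) \<ge> - (\<delta> / 2 * (1 + (x - a)\<^sup>2))"
    proof -
      have "0 \<le> \<delta> / 2 * (x - a + 1)\<^sup>2" using \<delta> by simp
      then show ?thesis by (simp add: power2_eq_square algebra_simps)
    qed
    ultimately have "q x = p x * exp (\<delta> * (x - a) - \<delta>\<^sup>2 / 2)"
        and "exp (\<delta> * (x - a) - \<delta>\<^sup>2 / 2) \<ge> 1 - b x"
      unfolding b_def by linarith+
    then have "q x \<ge> p x * (1 - b x)" using p by simp
    moreover have "b x \<ge> 0" using \<delta> by (simp add: b_def)
    ultimately show ?thesis using p by (auto simp: min_def algebra_simps)
  qed
  have "has_bochner_integral lborel (\<lambda>x. p x * (x - a)\<^sup>2) 1"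
    using normal_moment_even[of 1 a 1] by (simp add: p_def)
  moreover have "has_bochner_integral lborel p 1"
    unfolding p_def by (simp add: has_bochner_integral_iff)
  ultimately have "has_bochner_integral lborel
      (\<lambda>x. (\<delta>\<^sup>2 / 2 + \<delta> / 2) * p x + \<delta> / 2 * (p x * (x - a)\<^sup>2))
      ((\<delta>\<^sup>2 / 2 + \<delta> / 2) * 1 + \<delta> / 2 * 1)"
    by (intro has_bochner_integral_add has_bochner_integral_mult_right)
  then have int: "has_bochner_integral lborel (\<lambda>x. p x * b x) (\<delta>\<^sup>2 / 2 + \<delta>)"
    by (simp add: b_def algebra_simps)
  have "emeasure (gauss a \<Otimes>\<^sub>M unif) (moved a \<delta>)
      = (\<integral>\<^sup>+ z. indicator (moved a \<delta>) z \<partial>(gauss a \<Otimes>\<^sub>M unif))"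
    by simp
  also have "\<dots> = (\<integral>\<^sup>+ z. (if z \<in> moved a \<delta> then 1 else 0) \<partial>(gauss a \<Otimes>\<^sub>M unif))"
    by (intro nn_integral_cong) (simp add: indicator_def)
  also have "\<dots> = (\<integral>\<^sup>+ x. ennreal (p x - min (p x) (q x)) \<partial>lborel)"
    using nn_integral_gauss_unif[of "\<lambda>_. 0" "\<lambda>_. 1" a \<delta>] by (simp add: p_def q_def)
  also have "\<dots> \<le> (\<integral>\<^sup>+ x. ennreal (p x * b x) \<partial>lborel)"
    by (intro nn_integral_mono ennreal_leI bound)
  also have "\<dots> = ennreal (\<delta>\<^sup>2 / 2 + \<delta>)"
    using int \<delta> by (subst nn_integral_eq_integral) (auto simp: has_bochner_integral_iff b_def p_def)
  also have "\<dots> \<le> ennreal (2 * \<delta>)"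
    using \<delta> mult_left_le[of \<delta> \<delta>] by (intro ennreal_leI) (simp add: power2_eq_square)
  finally show ?thesis .
qed

subsection \<open>Moving one coordinate of the mean of a Gaussian dataset\<close>

lemma distr_fst_gauss_unif: "distr (gauss a \<Otimes>\<^sub>M unif) borel fst = gauss a"
proof -
  interpret U: prob_space unif by (rule prob_space_unif)
  have "distr (gauss a \<Otimes>\<^sub>M unif) borel fst = distr (gauss a \<Otimes>\<^sub>M unif) (gauss a) fst"
    by (rule distr_cong) simp_all
  then show ?thesis by (simp add: U.distr_pair_fst)
qed

lemma prob_gauss_data: "prob_space (gauss_data d n \<nu>)"
  unfolding gauss_data_def by (intro prob_space_PiM prob_space_gauss)

lemma sets_gauss_data: "sets (gauss_data d n \<nu>) = sets (data_space d n)"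
  unfolding gauss_data_def data_space_def by (intro sets_PiM_cong refl) simp

lemma space_gauss_data: "space (gauss_data d n \<nu>) = datasets d n"
  unfolding gauss_data_def datasets_def vecs_def by (simp add: space_PiM)

lemma coord_measurable:
  assumes "meas_estimator d n f" "j < d"
  shows "(\<lambda>X. f X j) \<in> borel_measurable (gauss_data d n \<nu>)"
  using assms by (simp add: meas_estimator_def measurable_cong_sets[OF sets_gauss_data refl])

text \<open>A single step of the mean along one coordinate axis.\<close>

locale mean_shift =
  fixes d n j :: nat and \<delta> :: real and \<mu> :: "nat \<Rightarrow> real"
  assumes j: "j < d" and \<delta>: "0 < \<delta>" "\<delta> \<le> 1"
begin

abbreviation gvec :: "(nat \<Rightarrow> real) measure" where
  "gvec \<equiv> PiM {..<d} (\<lambda>i. gauss (\<mu> i))"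

abbreviation uvec :: "(nat \<Rightarrow> real) measure" where
  "uvec \<equiv> PiM {..<d} (\<lambda>_. unif)"

abbreviation udata :: "(nat \<Rightarrow> nat \<Rightarrow> real) measure" where
  "udata \<equiv> PiM {..<n} (\<lambda>_. uvec)"

abbreviation shifted :: "nat \<Rightarrow> real" where
  "shifted \<equiv> \<mu>(j := \<mu> j + \<delta>)"

text \<open>Only entry \<open>j\<close> is coupled and the others are copied, so the probability
  that a row changes does not grow with the dimension.\<close>

definition vec_shift :: "(nat \<Rightarrow> real) \<times> (nat \<Rightarrow> real) \<Rightarrow> nat \<Rightarrow> real" where
  "vec_shift = rand_map {..<d} (\<lambda>i. if i = j then gauss_shift (\<mu> j) \<delta> else fst)"

definition data_shift :: "(nat \<Rightarrow> nat \<Rightarrow> real) \<times> (nat \<Rightarrow> nat \<Rightarrow> real) \<Rightarrow> nat \<Rightarrow> nat \<Rightarrow> real" where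
  "data_shift = rand_map {..<n} (\<lambda>_. vec_shift)"

text \<open>Rows are counted by the coupling event rather than by inequality: the count is then a
  sum of independent indicators, and it still dominates the Hamming distance.\<close>

definition n_moved :: "(nat \<Rightarrow> nat \<Rightarrow> real) \<times> (nat \<Rightarrow> nat \<Rightarrow> real) \<Rightarrow> nat" where
  "n_moved z = card {i \<in> {..<n}. (fst z i j, snd z i j) \<in> moved (\<mu> j) \<delta>}"

lemma prob_gvec: "prob_space gvec"
  by (intro prob_space_PiM prob_space_gauss)

lemma prob_uvec: "prob_space uvec"
  by (intro prob_space_PiM prob_space_unif)

lemma prob_udata: "prob_space udata"
  by (intro prob_space_PiM prob_uvec)

lemma vec_shift_measurable: "vec_shift \<in> gvec \<Otimes>\<^sub>M uvec \<rightarrow>\<^sub>M PiM {..<d} (\<lambda>_. borel)"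
  unfolding vec_shift_def by (rule measurable_rand_map) simp

lemma distr_vec_shift:
  "distr (gvec \<Otimes>\<^sub>M uvec) (PiM {..<d} (\<lambda>_. borel)) vec_shift = PiM {..<d} (\<lambda>i. gauss (shifted i))"
proof -
  have "distr (gvec \<Otimes>\<^sub>M uvec) (PiM {..<d} (\<lambda>_. borel)) vec_shift
    = PiM {..<d} (\<lambda>i. distr (gauss (\<mu> i) \<Otimes>\<^sub>M unif) borel (if i = j then gauss_shift (\<mu> j) \<delta> else fst))"
    unfolding vec_shift_def
    by (rule distr_rand_map) (simp_all add: prob_space_gauss prob_space_unif)
  also have "\<dots> = PiM {..<d} (\<lambda>i. gauss (shifted i))"
    by (intro PiM_cong refl) (simp add: distr_gauss_shift distr_fst_gauss_unif)
  finally show ?thesis .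
qed

lemma data_shift_measurable:
  "data_shift \<in> gauss_data d n \<mu> \<Otimes>\<^sub>M udata \<rightarrow>\<^sub>M PiM {..<n} (\<lambda>_. PiM {..<d} (\<lambda>_. borel))"
  unfolding data_shift_def gauss_data_def by (rule measurable_rand_map) (rule vec_shift_measurable)

text \<open>The law of \<open>rand_map\<close> is used a second time, now with whole rows as
  coordinates.\<close>

lemma distr_data_shift:
  "distr (gauss_data d n \<mu> \<Otimes>\<^sub>M udata) (PiM {..<n} (\<lambda>_. PiM {..<d} (\<lambda>_. borel))) data_shift
    = gauss_data d n shifted"
  unfolding data_shift_def gauss_data_def
  by (subst distr_rand_map)
     (simp_all only: finite_lessThan prob_gvec prob_uvec vec_shift_measurable distr_vec_shift)

lemma data_shift_in_datasets: "data_shift z \<in> datasets d n"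
  by (auto simp: data_shift_def vec_shift_def rand_map_def datasets_def vecs_def)

text \<open>Outside \<open>moved\<close> the map \<open>gauss_shift\<close> keeps the first
  component. Equality of rows as functions also uses that elements of \<open>vecs d\<close> are
  extensional.\<close>

lemma hamming_data_shift:
  assumes "X \<in> datasets d n"
  shows "hamming n X (data_shift (X, u)) \<le> n_moved (X, u)"
proof -
  have "data_shift (X, u) i = X i" if "i < n" "(X i j, u i j) \<notin> moved (\<mu> j) \<delta>" for i
  proof
    fix l
    have "X i \<in> vecs d" using assms that by (auto simp: datasets_def)
    then show "data_shift (X, u) i l = X i l"
      using that by (auto simp: data_shift_def vec_shift_def rand_map_def gauss_shift_def vecs_def PiE_def extensional_def)
  qed
  then have "{i \<in> {..<n}. X i \<noteq> data_shift (X, u) i}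
      \<subseteq> {i \<in> {..<n}. (fst (X, u) i j, snd (X, u) i j) \<in> moved (\<mu> j) \<delta>}"
    by auto
  then show ?thesis
    unfolding hamming_def n_moved_def by (intro card_mono) auto
qed

lemma vec_coord_measurable:
  "(\<lambda>z. (fst z j, snd z j)) \<in> gvec \<Otimes>\<^sub>M uvec \<rightarrow>\<^sub>M borel \<Otimes>\<^sub>M borel"
proof -
  have "(\<lambda>x. x j) \<in> gvec \<rightarrow>\<^sub>M gauss (\<mu> j)" "(\<lambda>x. x j) \<in> uvec \<rightarrow>\<^sub>M unif"
    using j by (auto intro!: measurable_component_singleton)
  then have [measurable]: "(\<lambda>x. x j) \<in> gvec \<rightarrow>\<^sub>M borel" "(\<lambda>x. x j) \<in> uvec \<rightarrow>\<^sub>M borel"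
    by simp_all
  show ?thesis by measurable
qed

lemma data_coord_measurable:
  assumes "i < n"
  shows "(\<lambda>z. (fst z i j, snd z i j)) \<in> gauss_data d n \<mu> \<Otimes>\<^sub>M udata \<rightarrow>\<^sub>M borel \<Otimes>\<^sub>M borel"
proof -
  have "(\<lambda>z. (fst z i, snd z i)) \<in> gauss_data d n \<mu> \<Otimes>\<^sub>M udata \<rightarrow>\<^sub>M gvec \<Otimes>\<^sub>M uvec"
    unfolding gauss_data_def using assms
    by (intro measurable_Pair measurable_compose[OF measurable_fst measurable_component_singleton]
          measurable_compose[OF measurable_snd measurable_component_singleton]) auto
  from measurable_compose[OF this vec_coord_measurable] show ?thesis by simp
qed

section \<open>Chernoff bound for the number of moved rows\<close>

lemma far_measurable: "{z \<in> space (gauss_data d n \<mu> \<Otimes>\<^sub>M udata). k < n_moved z} \<in> sets (gauss_data d n \<mu> \<Otimes>\<^sub>M udata)"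
proof -
  have eq: "real (n_moved z) = (\<Sum>i<n. indicator (moved (\<mu> j) \<delta>) (fst z i j, snd z i j))" for z
    by (simp add: n_moved_def indicator_def of_bool_def sum.If_cases Int_def)
  have "(\<lambda>z. \<Sum>i<n. indicator (moved (\<mu> j) \<delta>) (fst z i j, snd z i j) :: real)
      \<in> borel_measurable (gauss_data d n \<mu> \<Otimes>\<^sub>M udata)"
    by (intro borel_measurable_sum measurable_compose[OF data_coord_measurable]) auto
  then have [measurable]: "(\<lambda>z. real (n_moved z)) \<in> borel_measurable (gauss_data d n \<mu> \<Otimes>\<^sub>M udata)"
    unfolding eq .
  have "{z \<in> space (gauss_data d n \<mu> \<Otimes>\<^sub>M udata). real k < real (n_moved z)} \<in> sets (gauss_data d n \<mu> \<Otimes>\<^sub>M udata)"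
    by measurable
  then show ?thesis by simp
qed

text \<open>Marginalisation to entry \<open>j\<close>: the other entries contribute the factor 1 to
  the product of integrals.\<close>

lemma vec_moved_le:
  "(\<integral>\<^sup>+ z. indicator (moved (\<mu> j) \<delta>) (fst z j, snd z j) \<partial>(gvec \<Otimes>\<^sub>M uvec)) \<le> ennreal (2 * \<delta>)"
proof -
  define h :: "nat \<Rightarrow> real \<times> real \<Rightarrow> ennreal" where
    "h i z = (if i = j then indicator (moved (\<mu> j) \<delta>) z else 1)" for i z
  have prob: "prob_space (gauss a \<Otimes>\<^sub>M unif)" for a
    by (intro prob_space_pair prob_space_gauss prob_space_unif)
  have "(\<integral>\<^sup>+ z. indicator (moved (\<mu> j) \<delta>) (fst z j, snd z j) \<partial>(gvec \<Otimes>\<^sub>M uvec))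
      = (\<integral>\<^sup>+ z. (\<Prod>i<d. h i (fst z i, snd z i)) \<partial>(gvec \<Otimes>\<^sub>M uvec))"
    using j by (intro nn_integral_cong) (simp add: h_def prod.delta)
  also have "\<dots> = (\<Prod>i<d. \<integral>\<^sup>+ z. h i z \<partial>(gauss (\<mu> i) \<Otimes>\<^sub>M unif))"
    by (rule nn_integral_pair_PiM_prod) (simp_all add: prob_space_gauss prob_space_unif h_def[abs_def])
  also have "\<dots> = (\<Prod>i<d. if i = j then emeasure (gauss (\<mu> j) \<Otimes>\<^sub>M unif) (moved (\<mu> j) \<delta>) else 1)"
    by (intro prod.cong refl) (auto simp: h_def prob_space.emeasure_space_1[OF prob])
  also have "\<dots> = emeasure (gauss (\<mu> j) \<Otimes>\<^sub>M unif) (moved (\<mu> j) \<delta>)"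
    using j by (simp add: prod.delta)
  also have "\<dots> \<le> ennreal (2 * \<delta>)"
    using \<delta> by (intro emeasure_moved_le) auto
  finally show ?thesis .
qed

text \<open>Chernoff bound with exponential parameter 1. The factor \<open>h\<close> is the
  exponential of one row's indicator, so its product over the rows is the exponential of
  \<open>n_moved\<close>, and independence turns the expectation into an \<open>n\<close>-th
  power.\<close>

lemma emeasure_far_le:
  "emeasure (gauss_data d n \<mu> \<Otimes>\<^sub>M udata) {z \<in> space (gauss_data d n \<mu> \<Otimes>\<^sub>M udata). k < n_moved z}
    \<le> ennreal (exp (4 * \<delta> * real n - real k))" (is "emeasure ?\<Omega> ?F \<le> _")
proof -
  define B where "B = moved (\<mu> j) \<delta>"
  define h where "h z = (if (fst z j, snd z j) \<in> B then ennreal (exp 1) else 1)"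
    for z :: "(nat \<Rightarrow> real) \<times> (nat \<Rightarrow> real)"
  have B[measurable]: "B \<in> sets (borel \<Otimes>\<^sub>M borel)" by (simp add: B_def)
  have ind[measurable]: "(\<lambda>z. indicator B (fst z j, snd z j) :: ennreal) \<in> borel_measurable (gvec \<Otimes>\<^sub>M uvec)"
    by (rule measurable_compose[OF vec_coord_measurable]) simp
  have h_meas: "h \<in> borel_measurable (gvec \<Otimes>\<^sub>M uvec)"
    unfolding h_def[abs_def] by (rule measurable_compose[OF vec_coord_measurable]) simp
  have h_prod: "(\<Prod>i<n. h (fst z i, snd z i)) = ennreal (exp (real (n_moved z)))" for z
  proof -
    have "(\<Prod>i<n. h (fst z i, snd z i)) = (\<Prod>i\<in>{i \<in> {..<n}. (fst z i j, snd z i j) \<in> B}. ennreal (exp 1))"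
      unfolding h_def by (simp add: prod.inter_filter[symmetric])
    also have "\<dots> = ennreal (exp 1 ^ n_moved z)"
      by (simp add: n_moved_def B_def ennreal_power)
    finally show ?thesis by (simp add: exp_of_nat_mult[symmetric])
  qed
  have h_int: "(\<integral>\<^sup>+ z. h z \<partial>(gvec \<Otimes>\<^sub>M uvec)) \<le> ennreal (exp (4 * \<delta>))"
  proof -
    have "(\<integral>\<^sup>+ z. h z \<partial>(gvec \<Otimes>\<^sub>M uvec))
        \<le> (\<integral>\<^sup>+ z. 1 + 2 * indicator B (fst z j, snd z j) \<partial>(gvec \<Otimes>\<^sub>M uvec))"
    proof (rule nn_integral_mono)
      fix z
      \<comment> \<open>The crude bound 3 for \<open>exp 1\<close> produces the factor 2, hence the
        rate 4 \<delta>.\<close>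
      have "ennreal (exp 1) \<le> ennreal 3" using exp_le by (rule ennreal_leI)
      then show "h z \<le> 1 + 2 * indicator B (fst z j, snd z j)"
        by (simp add: h_def indicator_def)
    qed
    also have "\<dots> = 1 + 2 * (\<integral>\<^sup>+ z. indicator B (fst z j, snd z j) \<partial>(gvec \<Otimes>\<^sub>M uvec))"
      using prob_space.emeasure_space_1[OF prob_space_pair[OF prob_gvec prob_uvec]]
      by (simp add: nn_integral_add nn_integral_cmult)
    also have "\<dots> \<le> 1 + 2 * ennreal (2 * \<delta>)"
      unfolding B_def by (intro add_left_mono mult_left_mono vec_moved_le) simp
    also have "\<dots> = ennreal 1 + ennreal 2 * ennreal (2 * \<delta>)" by simp
    also have "\<dots> = ennreal (1 + 2 * (2 * \<delta>))"
      using \<delta> by (simp only: ennreal_plus ennreal_mult)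
    also have "\<dots> = ennreal (1 + 4 * \<delta>)" by simp
    also have "\<dots> \<le> ennreal (exp (4 * \<delta>))"
      by (intro ennreal_leI exp_ge_add_one_self)
    finally show ?thesis .
  qed
  have "emeasure ?\<Omega> ?F = (\<integral>\<^sup>+ z. indicator ?F z \<partial>?\<Omega>)"
    using far_measurable by simp
  also have "\<dots> \<le> (\<integral>\<^sup>+ z. ennreal (exp (- real k)) * (\<Prod>i<n. h (fst z i, snd z i)) \<partial>?\<Omega>)"
  proof (rule nn_integral_mono)
    fix z
    have "ennreal 1 \<le> ennreal (exp (real (n_moved z) - real k))" if "k < n_moved z"
      using that by (intro ennreal_leI) simp
    then show "indicator ?F z \<le> ennreal (exp (- real k)) * (\<Prod>i<n. h (fst z i, snd z i))"
      by (auto simp: h_prod indicator_def ennreal_mult[symmetric] exp_add[symmetric])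
  qed
  also have "\<dots> = ennreal (exp (- real k)) * (\<integral>\<^sup>+ z. (\<Prod>i<n. h (fst z i, snd z i)) \<partial>?\<Omega>)"
    unfolding gauss_data_def
    by (intro nn_integral_cmult borel_measurable_prod_ennreal measurable_compose[OF _ h_meas]) measurable
  also have "(\<integral>\<^sup>+ z. (\<Prod>i<n. h (fst z i, snd z i)) \<partial>?\<Omega>) = (\<integral>\<^sup>+ z. h z \<partial>(gvec \<Otimes>\<^sub>M uvec)) ^ n"
    unfolding gauss_data_def
    by (subst nn_integral_pair_PiM_prod) (simp_all add: prob_gvec prob_uvec h_meas)
  also have "\<dots> \<le> ennreal (exp (4 * \<delta>)) ^ n"
    by (intro power_mono h_int) simp
  also have "ennreal (exp (- real k)) * ennreal (exp (4 * \<delta>)) ^ n = ennreal (exp (4 * \<delta> * real n - real k))"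
    by (simp add: ennreal_power ennreal_mult[symmetric] exp_of_nat_mult[symmetric] exp_add[symmetric] mult_ac)
  finally show ?thesis by (simp add: mult_left_mono)
qed

section \<open>Increment of the expectation under the coupling\<close>

lemma coord_measurable_PiM_borel:
  assumes "meas_estimator d n f"
  shows "(\<lambda>X. f X j) \<in> borel_measurable (PiM {..<n} (\<lambda>_. PiM {..<d} (\<lambda>_. borel)))"
proof -
  have "(\<lambda>X. f X j) \<in> borel_measurable (data_space d n)"
    using assms j by (simp add: meas_estimator_def)
  moreover have "sets (data_space d n) = sets (PiM {..<n} (\<lambda>_. PiM {..<d} (\<lambda>_. borel :: real measure)))"
    unfolding data_space_def by (intro sets_PiM_cong refl) simp
  ultimately show ?thesis
    using measurable_cong_sets by blast
qed

text \<open>The shifted dataset is a competitor in the supremum defining \<open>sens\<close>, and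
  one coordinate is bounded by the Euclidean distance.\<close>

lemma sens_ge_shift:
  assumes "X \<in> datasets d n" and "n_moved (X, u) \<le> nat \<lfloor>\<eta> * real n\<rfloor>"
  shows "ennreal \<bar>f (data_shift (X, u)) j - f X j\<bar> \<le> sens d n f \<eta> X"
proof -
  let ?Y = "data_shift (X, u)"
  have "(f X j - f ?Y j)\<^sup>2 \<le> (\<Sum>i<d. (f X i - f ?Y i)\<^sup>2)"
    using j by (intro member_le_sum) auto
  then have "\<bar>f ?Y j - f X j\<bar> \<le> dist_d d (f X) (f ?Y)"
    unfolding dist_d_def by (intro real_le_rsqrt) (simp add: power2_commute)
  also have "ennreal (dist_d d (f X) (f ?Y)) \<le> sens d n f \<eta> X"
    unfolding sens_def using assms hamming_data_shift[OF assms(1), of u] data_shift_in_datasets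
    by (intro SUP_upper) auto
  finally show ?thesis by (simp add: ennreal_leI)
qed

text \<open>The function \<open>sens\<close> need not be measurable, so its integral cannot be transported along
  the coupling. Instead the auxiliary randomness is integrated out for each fixed dataset, which
  yields a measurable function below \<open>sens\<close>.\<close>

lemma nn_integral_near_le:
  fixes \<eta> :: real
  assumes f: "meas_estimator d n f"
  defines "k \<equiv> nat \<lfloor>\<eta> * real n\<rfloor>"
  shows "(\<integral>\<^sup>+ z. ennreal (if k < n_moved z then 0 else (f (data_shift z) j - f (fst z) j)\<^sup>2)
            \<partial>(gauss_data d n \<mu> \<Otimes>\<^sub>M udata))
    \<le> (\<integral>\<^sup>+ X. (sens d n f \<eta> X)\<^sup>2 \<partial>gauss_data d n \<mu>)"
proof -
  let ?\<Omega> = "gauss_data d n \<mu> \<Otimes>\<^sub>M udata"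
  let ?g = "\<lambda>z. ennreal (if k < n_moved z then 0 else (f (data_shift z) j - f (fst z) j)\<^sup>2)"
  interpret U: prob_space udata by (rule prob_udata)
  note far_measurable[measurable]
  have [measurable]: "(\<lambda>z. f (data_shift z) j) \<in> borel_measurable ?\<Omega>"
    by (rule measurable_compose[OF data_shift_measurable coord_measurable_PiM_borel[OF f]])
  have [measurable]: "(\<lambda>z. f (fst z) j) \<in> borel_measurable ?\<Omega>"
    by (rule measurable_compose[OF measurable_fst coord_measurable[OF f j]])
  have "?g \<in> borel_measurable ?\<Omega>"
    by measurable
  then have "(\<integral>\<^sup>+ z. ?g z \<partial>?\<Omega>) = (\<integral>\<^sup>+ X. \<integral>\<^sup>+ u. ?g (X, u) \<partial>udata \<partial>gauss_data d n \<mu>)"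
    by (rule sigma_finite_measure.nn_integral_fst[symmetric, OF prob_space_imp_sigma_finite[OF prob_udata]])
  also have "\<dots> \<le> (\<integral>\<^sup>+ X. (sens d n f \<eta> X)\<^sup>2 \<partial>gauss_data d n \<mu>)"
  proof (rule nn_integral_mono)
    fix X assume "X \<in> space (gauss_data d n \<mu>)"
    then have X: "X \<in> datasets d n" by (simp add: space_gauss_data)
    have "?g (X, u) \<le> (sens d n f \<eta> X)\<^sup>2" for u
    proof (cases "k < n_moved (X, u)")
      case False
      then have "(ennreal \<bar>f (data_shift (X, u)) j - f X j\<bar>)\<^sup>2 \<le> (sens d n f \<eta> X)\<^sup>2"
        using X by (intro power_mono sens_ge_shift) (auto simp: k_def)
      then show ?thesis using False by (simp add: ennreal_power)
    qed simp
    then have "(\<integral>\<^sup>+ u. ?g (X, u) \<partial>udata) \<le> (\<integral>\<^sup>+ u. (sens d n f \<eta> X)\<^sup>2 \<partial>udata)"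
      by (intro nn_integral_mono)
    then show "(\<integral>\<^sup>+ u. ?g (X, u) \<partial>udata) \<le> (sens d n f \<eta> X)\<^sup>2"
      by (simp add: U.emeasure_space_1)
  qed
  finally show ?thesis .
qed

text \<open>Under the coupling the difference of expectations is the mean of one increment. Where
  few rows moved, the sensitivity controls it; the remaining event is rare, and there the squared
  errors at both means control it. These errors stay explicit because only their sum along a line
  will be bounded, and the weight \<open>s\<close> stays free to be tuned later.\<close>

lemma mean_step:
  fixes \<eta> :: real
  assumes f: "meas_estimator d n f"
    and int: "integrable (gauss_data d n \<mu>) (\<lambda>X. (f X j - \<mu> j)\<^sup>2)"
    and int': "integrable (gauss_data d n shifted) (\<lambda>X. (f X j - shifted j)\<^sup>2)"
    and sens: "(\<integral>\<^sup>+ X. (sens d n f \<eta> X)\<^sup>2 \<partial>gauss_data d n \<mu>) \<le> ennreal (\<alpha>\<^sup>2)"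
    and \<alpha>: "\<alpha> > 0" and s: "s > 0"
  defines "k \<equiv> nat \<lfloor>\<eta> * real n\<rfloor>"
  shows "(\<integral>X. f X j \<partial>gauss_data d n shifted) - (\<integral>X. f X j \<partial>gauss_data d n \<mu>)
    \<le> \<alpha> + exp (4 * \<delta> * real n - real k) / (2 * s)
      + 3 * s / 2 * ((\<integral>X. (f X j - \<mu> j)\<^sup>2 \<partial>gauss_data d n \<mu>)
        + (\<integral>X. (f X j - shifted j)\<^sup>2 \<partial>gauss_data d n shifted) + \<delta>\<^sup>2)"
proof -
  define P P' N \<Omega> where "P = gauss_data d n \<mu>" and "P' = gauss_data d n shifted"
    and "N = PiM {..<n} (\<lambda>_. PiM {..<d} (\<lambda>_. borel :: real measure))"
    and "\<Omega> = P \<Otimes>\<^sub>M udata"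
  define \<phi> where "\<phi> X = f X j" for X
  define F where "F = {z \<in> space \<Omega>. k < n_moved z}"
  interpret P: prob_space P unfolding P_def by (rule prob_gauss_data)
  interpret P': prob_space P' unfolding P'_def by (rule prob_gauss_data)
  interpret \<Omega>: prob_space \<Omega>
    unfolding \<Omega>_def P_def by (intro prob_space_pair prob_gauss_data prob_udata)
  have \<phi>P[measurable]: "\<phi> \<in> borel_measurable P" and \<phi>P'[measurable]: "\<phi> \<in> borel_measurable P'"
    and \<phi>N[measurable]: "\<phi> \<in> borel_measurable N"
    using coord_measurable[OF f j] coord_measurable_PiM_borel[OF f] by (simp_all add: P_def P'_def N_def \<phi>_def[abs_def])
  have ds: "data_shift \<in> \<Omega> \<rightarrow>\<^sub>M N"
    unfolding \<Omega>_def P_def N_def by (rule data_shift_measurable)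
  have fst: "fst \<in> \<Omega> \<rightarrow>\<^sub>M P" by (simp add: \<Omega>_def)
  have P'_eq: "P' = distr \<Omega> N data_shift"
    unfolding \<Omega>_def P_def N_def P'_def by (rule distr_data_shift[symmetric])
  have P_eq: "P = distr \<Omega> P fst"
    unfolding \<Omega>_def by (rule prob_space.distr_pair_fst[OF prob_udata, symmetric])

  have to_P': "integrable P' h \<longleftrightarrow> integrable \<Omega> (\<lambda>z. h (data_shift z))"
      "integral\<^sup>L P' h = (\<integral>z. h (data_shift z) \<partial>\<Omega>)" if "h \<in> borel_measurable N" for h :: "_ \<Rightarrow> real"
    unfolding P'_eq using that ds by (simp_all add: integrable_distr_eq integral_distr)
  have to_P: "integrable P h \<longleftrightarrow> integrable \<Omega> (\<lambda>z. h (fst z))"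
      "integral\<^sup>L P h = (\<integral>z. h (fst z) \<partial>\<Omega>)" if "h \<in> borel_measurable P" for h :: "_ \<Rightarrow> real"
    using integrable_distr_eq[OF fst that] integral_distr[OF fst that]
    unfolding P_eq[symmetric] by simp_all

  have "integrable P (\<lambda>X. \<phi> X - \<mu> j)"
    by (rule P.square_integrable_imp_integrable[OF _ int[folded P_def \<phi>_def]]) measurable
  then have "integrable P (\<lambda>X. (\<phi> X - \<mu> j) + \<mu> j)" by (rule Bochner_Integration.integrable_add) simp
  then have i1: "integrable \<Omega> (\<lambda>z. \<phi> (fst z))"
    using to_P(1)[OF \<phi>P] by simp
  have "integrable P' (\<lambda>X. \<phi> X - shifted j)"
    by (rule P'.square_integrable_imp_integrable[OF _ int'[folded P'_def \<phi>_def]]) measurable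
  then have "integrable P' (\<lambda>X. (\<phi> X - shifted j) + shifted j)"
    by (rule Bochner_Integration.integrable_add) simp
  then have i2: "integrable \<Omega> (\<lambda>z. \<phi> (data_shift z))"
    using to_P'(1)[OF \<phi>N] by simp
  \<comment> \<open>Errors at the two means and the increment of the estimate, related by
    \<open>D z = b z - a z + \<delta>\<close>.\<close>
  define a b D where "a z = \<phi> (fst z) - \<mu> j" and "b z = \<phi> (data_shift z) - shifted j"
    and "D z = \<phi> (data_shift z) - \<phi> (fst z)" for z
  have ia: "integrable \<Omega> (\<lambda>z. (a z)\<^sup>2)" and ea: "(\<integral>z. (a z)\<^sup>2 \<partial>\<Omega>) = (\<integral>X. (\<phi> X - \<mu> j)\<^sup>2 \<partial>P)"
    using to_P[of "\<lambda>X. (\<phi> X - \<mu> j)\<^sup>2"] int[folded P_def \<phi>_def] by (simp_all add: a_def)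
  have ib: "integrable \<Omega> (\<lambda>z. (b z)\<^sup>2)" and eb: "(\<integral>z. (b z)\<^sup>2 \<partial>\<Omega>) = (\<integral>X. (\<phi> X - shifted j)\<^sup>2 \<partial>P')"
    using to_P'[of "\<lambda>X. (\<phi> X - shifted j)\<^sup>2"] int'[folded P'_def \<phi>_def] by (simp_all add: b_def)
  have D_sq: "(D z)\<^sup>2 \<le> 3 * ((a z)\<^sup>2 + (b z)\<^sup>2 + \<delta>\<^sup>2)" for z
  proof -
    have D: "D z = b z - a z + \<delta>" by (simp add: D_def a_def b_def)
    \<comment> \<open>The difference of the two sides of the claim is exactly this sum of
      squares.\<close>
    have "0 \<le> (a z + b z)\<^sup>2 + (a z + \<delta>)\<^sup>2 + (b z - \<delta>)\<^sup>2" by simp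
    then show ?thesis unfolding D by (simp add: power2_eq_square algebra_simps)
  qed

  have F[measurable]: "F \<in> sets \<Omega>"
    unfolding F_def \<Omega>_def P_def by (rule far_measurable)
  have D_meas[measurable]: "D \<in> borel_measurable \<Omega>"
    unfolding D_def[abs_def] using i1 i2 by (intro borel_measurable_diff) auto
  \<comment> \<open>The squared increment cut off to the event where the sensitivity bound
    applies.\<close>
  define G where "G z = (D z)\<^sup>2 * indicator (space \<Omega> - F) z" for z
  have G_meas: "G \<in> borel_measurable \<Omega>" unfolding G_def[abs_def] by measurable
  have "(\<integral>\<^sup>+ z. ennreal (G z) \<partial>\<Omega>)
      = (\<integral>\<^sup>+ z. ennreal (if k < n_moved z then 0 else (f (data_shift z) j - f (fst z) j)\<^sup>2) \<partial>\<Omega>)"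
    by (intro nn_integral_cong) (auto simp: G_def F_def D_def \<phi>_def indicator_def)
  also have "\<dots> \<le> ennreal (\<alpha>\<^sup>2)"
    using nn_integral_near_le[OF f, of \<eta>] sens unfolding k_def \<Omega>_def P_def by (rule order_trans)
  finally have G_nn: "(\<integral>\<^sup>+ z. ennreal (G z) \<partial>\<Omega>) \<le> ennreal (\<alpha>\<^sup>2)" .
  have G0: "G z \<ge> 0" for z by (simp add: G_def)
  have iG: "integrable \<Omega> G"
    by (rule integrableI_nonneg) (use G_meas G0 G_nn in \<open>auto simp: le_less_trans\<close>)
  have eG: "integral\<^sup>L \<Omega> G \<le> \<alpha>\<^sup>2"
    using G_nn G0 by (simp add: nn_integral_eq_integral[OF iG])
  have eF: "(\<integral>z. indicator F z \<partial>\<Omega>) \<le> exp (4 * \<delta> * real n - real k)"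
  proof -
    have "emeasure \<Omega> F \<le> ennreal (exp (4 * \<delta> * real n - real k))"
      unfolding F_def \<Omega>_def P_def by (rule emeasure_far_le)
    then show ?thesis using F by (simp add: \<Omega>.emeasure_eq_measure)
  qed
  have iF: "integrable \<Omega> (indicator F :: _ \<Rightarrow> real)"
    by (simp add: \<Omega>.emeasure_eq_measure)

  text \<open>Both cases of the pointwise bound are AM-GM, with weights adapted to the size of the
    respective squares.\<close>
  have bound: "D z \<le> \<alpha> / 2 + G z / (2 * \<alpha>) + indicator F z / (2 * s)
      + 3 * s / 2 * ((a z)\<^sup>2 + (b z)\<^sup>2 + \<delta>\<^sup>2)" if z: "z \<in> space \<Omega>" for z
  proof (cases "z \<in> F")
    case False
    have "0 \<le> (D z - \<alpha>)\<^sup>2" by simp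
    then have "D z \<le> \<alpha> / 2 + (D z)\<^sup>2 / (2 * \<alpha>)"
      using \<alpha> by (simp add: field_simps power2_eq_square)
    moreover have "0 \<le> 3 * s / 2 * ((a z)\<^sup>2 + (b z)\<^sup>2 + \<delta>\<^sup>2)" using s by simp
    ultimately show ?thesis using False z by (simp add: G_def)
  next
    case True
    have "0 \<le> (s * D z - 1)\<^sup>2" by simp
    then have "D z \<le> 1 / (2 * s) + s / 2 * (D z)\<^sup>2"
      using s by (simp add: field_simps power2_eq_square)
    moreover have "s / 2 * (D z)\<^sup>2 \<le> s / 2 * (3 * ((a z)\<^sup>2 + (b z)\<^sup>2 + \<delta>\<^sup>2))"
      using s by (intro mult_left_mono D_sq) simp
    ultimately have "D z \<le> 1 / (2 * s) + 3 * s / 2 * ((a z)\<^sup>2 + (b z)\<^sup>2 + \<delta>\<^sup>2)"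
      by (simp add: algebra_simps)
    then show ?thesis using True \<alpha> by (simp add: G_def)
  qed
  have "(\<integral>z. D z \<partial>\<Omega>) \<le> (\<integral>z. \<alpha> / 2 + G z / (2 * \<alpha>) + indicator F z / (2 * s)
      + 3 * s / 2 * ((a z)\<^sup>2 + (b z)\<^sup>2 + \<delta>\<^sup>2) \<partial>\<Omega>)"
    using i1 i2 iG iF ia ib bound unfolding D_def
    by (intro integral_mono Bochner_Integration.integrable_add Bochner_Integration.integrable_diff
          integrable_mult_right integrable_divide) auto
  also have "\<dots> = \<alpha> / 2 + integral\<^sup>L \<Omega> G / (2 * \<alpha>) + (\<integral>z. indicator F z \<partial>\<Omega>) / (2 * s)
      + 3 * s / 2 * ((\<integral>z. (a z)\<^sup>2 \<partial>\<Omega>) + (\<integral>z. (b z)\<^sup>2 \<partial>\<Omega>) + \<delta>\<^sup>2)"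
    using iG iF ia ib by (simp add: \<Omega>.prob_space)
  also have "\<dots> \<le> \<alpha> / 2 + \<alpha>\<^sup>2 / (2 * \<alpha>) + exp (4 * \<delta> * real n - real k) / (2 * s)
      + 3 * s / 2 * ((\<integral>z. (a z)\<^sup>2 \<partial>\<Omega>) + (\<integral>z. (b z)\<^sup>2 \<partial>\<Omega>) + \<delta>\<^sup>2)"
    using eG eF \<alpha> s by (intro add_mono divide_right_mono) auto
  also have "\<alpha> / 2 + \<alpha>\<^sup>2 / (2 * \<alpha>) = \<alpha>"
    using \<alpha> by (simp add: power2_eq_square)
  finally have "(\<integral>z. D z \<partial>\<Omega>) \<le> \<alpha> + exp (4 * \<delta> * real n - real k) / (2 * s)
      + 3 * s / 2 * ((\<integral>X. (\<phi> X - \<mu> j)\<^sup>2 \<partial>P) + (\<integral>X. (\<phi> X - shifted j)\<^sup>2 \<partial>P') + \<delta>\<^sup>2)"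
    unfolding ea eb .
  moreover have "(\<integral>z. D z \<partial>\<Omega>) = integral\<^sup>L P' \<phi> - integral\<^sup>L P \<phi>"
    unfolding D_def using i1 i2 by (simp add: to_P(2)[OF \<phi>P] to_P'(2)[OF \<phi>N])
  ultimately show ?thesis
    by (simp only: P_def P'_def \<phi>_def[abs_def])
qed

end

subsection \<open>Telescoping along a line of the grid\<close>

lemma sum_lessThan_double:
  fixes g :: "nat \<Rightarrow> 'a::comm_monoid_add"
  shows "(\<Sum>l<2 * M. g l) = (\<Sum>l<M. g l) + (\<Sum>l<M. g (l + M))"
  using sum.atLeastLessThan_concat[of 0 M "2 * M" g] sum.shift_bounds_nat_ivl[of g 0 M M]
  by (simp add: lessThan_atLeast0 mult_2)

text \<open>Each step lowers \<open>h\<close> by \<open>A\<close> up to errors, so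
  \<open>h l - h (l + M)\<close> is at least \<open>M * (A - 4 * B * \<kappa>)\<close>. Averaging
  over all pairs at distance \<open>M\<close> is essential: only the average error on the line is
  controlled, and the two endpoints alone might be bad.\<close>

lemma drift_bound:
  fixes h e :: "nat \<Rightarrow> real"
  assumes "M > 0" "\<kappa> > 0" "B \<ge> 0"
    and he: "\<And>l. l < 2 * M \<Longrightarrow> (h l)\<^sup>2 \<le> e l"
    and e: "(\<Sum>l<2 * M. e l) \<le> 2 * real M * \<kappa>"
    and step: "\<And>l. Suc l < 2 * M \<Longrightarrow> h (Suc l) - h l \<le> - A + B * (e l + e (Suc l))"
  shows "real M * (A - 4 * B * \<kappa>) \<le> 2 * sqrt \<kappa>"
proof -
  define \<tau> where "\<tau> = sqrt \<kappa>"
  have \<tau>: "\<tau> > 0" "\<tau>\<^sup>2 = \<kappa>" using \<open>\<kappa> > 0\<close> by (simp_all add: \<tau>_def)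
  have e0: "e l \<ge> 0" if "l < 2 * M" for l using he[OF that] by (rule order_trans[rotated]) simp
  have "real M * A - 4 * B * real M * \<kappa> \<le> h l - h (l + M)" if l: "l < M" for l
  proof -
    have "h (l + M) - h l = (\<Sum>i<M. h (Suc (l + i)) - h (l + i))"
      by (subst sum_lessThan_telescope[of "\<lambda>i. h (l + i)", simplified]) simp
    also have "\<dots> \<le> (\<Sum>i<M. - A + B * (e (l + i) + e (Suc (l + i))))"
      using l by (intro sum_mono step) auto
    also have "\<dots> = - real M * A + B * ((\<Sum>i<M. e (l + i)) + (\<Sum>i<M. e (Suc l + i)))"
      by (simp add: sum.distrib sum_distrib_left[symmetric] sum_subtractf)
    \<comment> \<open>Both windows of length \<open>M\<close> lie inside the line and
      \<open>e\<close> is nonnegative there, so each window sum is at most the full sum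
      \<open>2 * M * \<kappa>\<close>.\<close>
    also have "(\<Sum>i<M. e (l + i)) \<le> (\<Sum>i<2 * M. e i)"
    proof -
      have "(\<Sum>i<M. e (l + i)) = sum e ((+) l ` {..<M})" by (simp add: sum.reindex)
      also have "\<dots> \<le> (\<Sum>i<2 * M. e i)" using l e0 by (intro sum_mono2) auto
      finally show ?thesis .
    qed
    moreover have "(\<Sum>i<M. e (Suc l + i)) \<le> (\<Sum>i<2 * M. e i)"
    proof -
      have "(\<Sum>i<M. e (Suc l + i)) = sum e ((+) (Suc l) ` {..<M})" by (simp add: sum.reindex inj_on_def)
      also have "\<dots> \<le> (\<Sum>i<2 * M. e i)" using l e0 by (intro sum_mono2) auto
      finally show ?thesis .
    qed
    ultimately have "h (l + M) - h l \<le> - real M * A + B * (2 * real M * \<kappa> + 2 * real M * \<kappa>)"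
      using e \<open>B \<ge> 0\<close> by (smt (verit) mult_left_mono)
    then show ?thesis by (simp add: algebra_simps)
  qed
  then have "(\<Sum>l<M. real M * A - 4 * B * real M * \<kappa>) \<le> (\<Sum>l<M. h l - h (l + M))"
    by (intro sum_mono) auto
  also have "\<dots> \<le> (\<Sum>l<M. \<bar>h l\<bar> + \<bar>h (l + M)\<bar>)"
    by (intro sum_mono) auto
  also have "\<dots> = (\<Sum>l<2 * M. \<bar>h l\<bar>)"
    by (simp add: sum_lessThan_double sum.distrib)
  \<comment> \<open>AM-GM with weight \<tau>, the bound on the root mean square error, which makes
    both terms sum to at most \<open>M * \<tau>\<close>.\<close>
  also have "\<dots> \<le> (\<Sum>l<2 * M. e l / (2 * \<tau>) + \<tau> / 2)"
  proof (rule sum_mono)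
    fix l assume "l \<in> {..<2 * M}"
    then have "(h l)\<^sup>2 \<le> e l" by (simp add: he)
    moreover have "0 \<le> (\<bar>h l\<bar> - \<tau>)\<^sup>2" by simp
    ultimately have "2 * \<tau> * \<bar>h l\<bar> \<le> e l + \<tau>\<^sup>2"
      by (simp add: power2_diff algebra_simps)
    then show "\<bar>h l\<bar> \<le> e l / (2 * \<tau>) + \<tau> / 2"
      using \<tau>(1) by (simp add: field_simps power2_eq_square)
  qed
  also have "\<dots> = (\<Sum>l<2 * M. e l) / (2 * \<tau>) + real M * \<tau>"
    by (simp add: sum.distrib sum_divide_distrib)
  also have "\<dots> \<le> 2 * real M * \<kappa> / (2 * \<tau>) + real M * \<tau>"
    using e \<tau>(1) by (intro add_right_mono divide_right_mono) auto
  also have "\<dots> = real M * (2 * \<tau>)"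
    using \<tau> by (simp add: \<tau>(2)[symmetric] power2_eq_square)
  finally have "real M * (real M * (A - 4 * B * \<kappa>)) \<le> real M * (2 * \<tau>)"
    by (simp add: algebra_simps)
  then show ?thesis using \<open>M > 0\<close> by (simp add: \<tau>_def)
qed

text \<open>The map \<open>(a, l) \<mapsto> (a(j := l), a j)\<close> is an involution of the grid times a line, so averaging
  over the lines in direction \<open>j\<close> is averaging over the grid.\<close>

lemma sum_grid_lines:
  fixes g :: "(nat \<Rightarrow> nat) \<Rightarrow> real" and L :: nat
  assumes j: "j < d"
  defines "G \<equiv> PiE {..<d} (\<lambda>_. {..<L})"
  shows "(\<Sum>a\<in>G. \<Sum>l<L. g (a(j := l))) = real L * (\<Sum>a\<in>G. g a)"
proof -
  define \<iota> :: "(nat \<Rightarrow> nat) \<times> nat \<Rightarrow> (nat \<Rightarrow> nat) \<times> nat" where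
    "\<iota> = (\<lambda>(a, l). (a(j := l), a j))"
  have \<iota>_mem: "\<iota> z \<in> G \<times> {..<L}" if "z \<in> G \<times> {..<L}" for z
    using that j by (auto simp: \<iota>_def G_def PiE_def Pi_def extensional_def split: if_splits)
  have \<iota>\<iota>: "\<iota> (\<iota> z) = z" for z by (simp add: \<iota>_def split: prod.split)
  have bij: "bij_betw \<iota> (G \<times> {..<L}) (G \<times> {..<L})"
    by (intro bij_betw_byWitness[where f' = \<iota>] ballI image_subsetI \<iota>_mem \<iota>\<iota>)
  have "(\<Sum>a\<in>G. \<Sum>l<L. g (a(j := l))) = (\<Sum>z\<in>G \<times> {..<L}. g (fst (\<iota> z)))"
    by (simp add: sum.cartesian_product \<iota>_def split_def)
  also have "\<dots> = (\<Sum>z\<in>G \<times> {..<L}. g (fst z))"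
    by (rule sum.reindex_bij_betw[OF bij])
  also have "\<dots> = (\<Sum>a\<in>G. \<Sum>l<L. g a)"
    by (simp only: sum.cartesian_product split_def)
  also have "\<dots> = real L * (\<Sum>a\<in>G. g a)"
    by (simp add: sum_distrib_left)
  finally show ?thesis .
qed

text \<open>If every line were bad, summing over directions and grid points would contradict the
  total error bound. Averaging over the \<open>d\<close> directions removes the factor
  \<open>d\<close>.\<close>

lemma ex_good_line:
  fixes e :: "nat \<Rightarrow> (nat \<Rightarrow> nat) \<Rightarrow> real"
  assumes "L > 0" "d > 0"
    and e: "\<And>a. a \<in> PiE {..<d} (\<lambda>_. {..<L}) \<Longrightarrow> (\<Sum>j<d. e j a) \<le> real d * \<kappa>"
  obtains j a where "j < d" "a \<in> PiE {..<d} (\<lambda>_. {..<L})" "(\<Sum>l<L. e j (a(j := l))) \<le> real L * \<kappa>"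
proof -
  define G where "G = PiE {..<d} (\<lambda>_::nat. {..<L})"
  have G: "finite G" "G \<noteq> {}"
    using \<open>L > 0\<close> by (auto simp: G_def PiE_eq_empty_iff intro!: finite_PiE)
  have "\<exists>j<d. \<exists>a\<in>G. (\<Sum>l<L. e j (a(j := l))) \<le> real L * \<kappa>"
  proof (rule ccontr)
    assume "\<not> ?thesis"
    then have "(\<Sum>l<L. e j (a(j := l))) > real L * \<kappa>" if "j < d" "a \<in> G" for j a
      using that by (meson not_le)
    then have "(\<Sum>j<d. \<Sum>a\<in>G. real L * \<kappa>) < (\<Sum>j<d. \<Sum>a\<in>G. \<Sum>l<L. e j (a(j := l)))"
      using G \<open>d > 0\<close> by (intro sum_strict_mono) auto
    also have "\<dots> = (\<Sum>j<d. real L * (\<Sum>a\<in>G. e j a))"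
      unfolding G_def by (intro sum.cong refl sum_grid_lines) simp
    also have "\<dots> = real L * (\<Sum>a\<in>G. \<Sum>j<d. e j a)"
      by (simp add: sum_distrib_left[symmetric] sum.swap[of _ _ G])
    also have "\<dots> \<le> real L * (\<Sum>a\<in>G. real d * \<kappa>)"
      by (intro mult_left_mono sum_mono e) (simp_all add: G_def)
    finally show False by (simp add: mult_ac)
  qed
  then show ?thesis using that by (auto simp: G_def)
qed

subsection \<open>Accuracy and sensitivity at a fixed mean\<close>

text \<open>Passes from the \<open>ennreal\<close> form of accuracy to real integrals, each
  coordinate being dominated by the full squared distance. The sharp bound concerns the sum over
  coordinates, which is why a direction has to be selected later.\<close>

lemma coord_mse:
  assumes f: "meas_estimator d n f" and acc: "mse_accurate C d n f" and C: "C \<ge> 0"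
    and \<mu>: "\<mu> \<in> vecs d"
  shows "\<And>j. j < d \<Longrightarrow> integrable (gauss_data d n \<mu>) (\<lambda>X. (f X j - \<mu> j)\<^sup>2)"
    and "(\<Sum>j<d. \<integral>X. (f X j - \<mu> j)\<^sup>2 \<partial>gauss_data d n \<mu>) \<le> C * real d / real n"
proof -
  let ?P = "gauss_data d n \<mu>"
  have m[measurable]: "(\<lambda>X. f X j) \<in> borel_measurable ?P" if "j < d" for j
    using coord_measurable[OF f that] .
  have dist: "(dist_d d x \<mu>)\<^sup>2 = (\<Sum>i<d. (x i - \<mu> i)\<^sup>2)" for x
    by (simp add: dist_d_def sum_nonneg)
  have nn: "(\<integral>\<^sup>+ X. ennreal (\<Sum>i<d. (f X i - \<mu> i)\<^sup>2) \<partial>?P) \<le> ennreal (C * real d / real n)"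
    using acc \<mu> by (auto simp: mse_accurate_def dist)
  have meas: "(\<lambda>X. \<Sum>i<d. (f X i - \<mu> i)\<^sup>2) \<in> borel_measurable ?P"
    by (intro borel_measurable_sum borel_measurable_power borel_measurable_diff m) auto
  have int: "integrable ?P (\<lambda>X. \<Sum>i<d. (f X i - \<mu> i)\<^sup>2)"
    by (rule integrableI_nonneg[OF meas]) (use nn in \<open>auto simp: sum_nonneg le_less_trans\<close>)
  show ij: "integrable ?P (\<lambda>X. (f X j - \<mu> j)\<^sup>2)" if "j < d" for j
  proof (rule Bochner_Integration.integrable_bound[OF int])
    show "(\<lambda>X. (f X j - \<mu> j)\<^sup>2) \<in> borel_measurable ?P" using that by simp
    have "(f X j - \<mu> j)\<^sup>2 \<le> (\<Sum>i<d. (f X i - \<mu> i)\<^sup>2)" for X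
      using that by (intro member_le_sum) auto
    then show "AE X in ?P. norm ((f X j - \<mu> j)\<^sup>2) \<le> norm (\<Sum>i<d. (f X i - \<mu> i)\<^sup>2)"
      by (simp add: sum_nonneg)
  qed
  have "(\<Sum>j<d. \<integral>X. (f X j - \<mu> j)\<^sup>2 \<partial>?P) = (\<integral>X. (\<Sum>i<d. (f X i - \<mu> i)\<^sup>2) \<partial>?P)"
    using ij by (subst Bochner_Integration.integral_sum) auto
  also have "\<dots> \<le> C * real d / real n"
    using nn C by (simp add: nn_integral_eq_integral[OF int] sum_nonneg)
  finally show "(\<Sum>j<d. \<integral>X. (f X j - \<mu> j)\<^sup>2 \<partial>?P) \<le> C * real d / real n" .
qed

text \<open>Squared bias is at most mean squared error, since the variance is nonnegative.\<close>

lemma coord_bias: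
  assumes f: "meas_estimator d n f" and j: "j < d"
    and int: "integrable (gauss_data d n \<mu>) (\<lambda>X. (f X j - \<mu> j)\<^sup>2)"
  shows "((\<integral>X. f X j \<partial>gauss_data d n \<mu>) - \<mu> j)\<^sup>2 \<le> (\<integral>X. (f X j - \<mu> j)\<^sup>2 \<partial>gauss_data d n \<mu>)"
proof -
  let ?P = "gauss_data d n \<mu>" and ?Y = "\<lambda>X. f X j - \<mu> j"
  interpret prob_space ?P by (rule prob_gauss_data)
  have [measurable]: "(\<lambda>X. f X j) \<in> borel_measurable ?P"
    using coord_measurable[OF f j] .
  have iY: "integrable ?P ?Y"
    by (rule square_integrable_imp_integrable[OF _ int]) simp
  then have "integrable ?P (\<lambda>X. ?Y X + \<mu> j)" by (rule Bochner_Integration.integrable_add) simp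
  then have "expectation ?Y = (\<integral>X. f X j \<partial>?P) - \<mu> j"
    by (simp add: prob_space)
  moreover have "(expectation ?Y)\<^sup>2 \<le> (\<integral>X. (?Y X)\<^sup>2 \<partial>?P)"
    using variance_eq[OF iY int] variance_positive[of ?Y] by linarith
  ultimately show ?thesis by simp
qed

lemma ES2_less_imp:
  assumes "ES2 d n f \<eta> \<mu> < ennreal \<alpha>" "\<alpha> \<ge> 0"
  shows "(\<integral>\<^sup>+ X. (sens d n f \<eta> X)\<^sup>2 \<partial>gauss_data d n \<mu>) \<le> ennreal (\<alpha>\<^sup>2)"
proof -
  define E where "E = (\<integral>\<^sup>+ X. (sens d n f \<eta> X)\<^sup>2 \<partial>gauss_data d n \<mu>)"
  \<comment> \<open>Infinity has to be excluded first, as \<open>enn2real\<close> would send it to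
    0.\<close>
  have fin: "E \<noteq> \<infinity>" using assms by (auto simp: ES2_def E_def[symmetric])
  then have "ennreal (sqrt (enn2real E)) < ennreal \<alpha>"
    using assms by (simp add: ES2_def E_def[symmetric])
  then have "sqrt (enn2real E) < \<alpha>" using assms(2) by (simp add: ennreal_less_iff)
  then have "enn2real E \<le> \<alpha>\<^sup>2"
    by (metis enn2real_nonneg less_imp_le real_sqrt_le_iff real_sqrt_abs abs_of_nonneg assms(2))
  then have "E \<le> ennreal (\<alpha>\<^sup>2)"
    using fin by (metis ennreal_enn2real ennreal_leI infinity_ennreal_def top.not_eq_extremum)
  then show ?thesis by (simp add: E_def)
qed

subsection \<open>The lower bound\<close>

text \<open>Of each step \<delta>, the sensitivity takes a quarter, the rare event 1/16, the term in
  \<open>\<delta>\<^sup>2\<close> at most 1/32 and the accumulated errors at most 1/8, which leaves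
  more than half.\<close>

lemma parameter_bounds:
  fixes C \<eta> :: real and n :: nat
  assumes C: "C > 0" and \<eta>: "0 < \<eta>" "\<eta> < 1/10"
    and n: "real n \<ge> 393216 * (C + 1)"
    and k: "real (nat \<lfloor>\<eta> * real n\<rfloor>) \<ge> 4 * ln (real n)"
  defines "\<delta> \<equiv> \<eta> / 32" and "\<kappa> \<equiv> C / real n" and "s \<equiv> \<eta> / 32 / (48 * (C + 1))"
  shows "\<delta> / 2 \<le> \<delta> - (\<eta> / 128 + exp (4 * \<delta> * real n - real (nat \<lfloor>\<eta> * real n\<rfloor>)) / (2 * s)
      + 3 * s / 2 * \<delta>\<^sup>2) - 4 * (3 * s / 2) * \<kappa>"
proof -
  define k where "k = nat \<lfloor>\<eta> * real n\<rfloor>"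
  \<comment> \<open>The ratio of \<open>s\<close> to \<delta>, chosen so that
    \<open>6 * \<sigma> * C\<close> is at most 1/8.\<close>
  define \<sigma> where "\<sigma> = 1 / (48 * (C + 1))"
  have s_eq: "s = \<sigma> * \<delta>" by (simp add: s_def \<sigma>_def \<delta>_def)
  have \<sigma>: "\<sigma> > 0" "\<sigma> \<le> 1/48" "6 * \<sigma> * C \<le> 1/8" using C by (simp_all add: \<sigma>_def field_simps)
  have n1: "real n > 1" using n C by simp
  have \<delta>: "\<delta> > 0" "\<delta> \<le> 1" using \<eta> by (simp_all add: \<delta>_def)
  have "real k > 0" using k n1 by (smt (verit) k_def ln_gt_zero)
  then have k1: "real k \<ge> 1" by simp
  have k_le: "real k \<le> \<eta> * real n" using \<eta> by (simp add: k_def)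
  have k_gt: "\<eta> * real n < real k + 1" unfolding k_def by linarith
  \<comment> \<open>As \<open>4 * \<delta> = \<eta> / 8\<close>, the first term is below
    \<open>(k + 1) / 8\<close>, hence at most \<open>k / 4\<close>. So at least three quarters of
    \<open>k\<close> remain, and \<open>k\<close> is at least \<open>4 * ln n\<close>.\<close>
  have "4 * \<delta> * real n - real k \<le> - 3 * ln (real n)"
    using k_gt k1 k unfolding k_def[symmetric] \<delta>_def by simp
  then have "exp (4 * \<delta> * real n - real k) \<le> exp (- (ln (real n) * 3))"
    by (subst exp_le_cancel_iff) simp
  also have "\<dots> = 1 / real n ^ 3"
    using n1 exp_of_nat_mult[of 3 "ln (real n)"] by (simp add: exp_minus field_simps)
  also have "\<dots> \<le> \<sigma> * \<delta>\<^sup>2 / 8"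
  proof -
    \<comment> \<open>Since \<open>k\<close> is at least 1, \<eta> is at least
      \<open>1 / n\<close>.\<close>
    have "1 / (32 * real n) \<le> \<delta>" using k_le k1 n1 by (simp add: \<delta>_def field_simps)
    then have "(1 / (32 * real n))\<^sup>2 \<le> \<delta>\<^sup>2" using n1 by (intro power_mono) auto
    then have "\<sigma> * (1 / (32 * real n))\<^sup>2 / 8 \<le> \<sigma> * \<delta>\<^sup>2 / 8"
      using \<sigma> by (intro divide_right_mono mult_left_mono) auto
    \<comment> \<open>The threshold for \<open>n\<close> comes from here: 393216 is 8192 times 48,
      and 8192 is 8 times the square of 32.\<close>
    moreover have "8192 / \<sigma> \<le> real n" using n by (simp add: \<sigma>_def)
    then have "8192 \<le> \<sigma> * real n" using \<sigma> by (simp add: field_simps)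
    then have "1 / real n ^ 3 \<le> \<sigma> * (1 / (32 * real n))\<^sup>2 / 8"
      using n1 by (simp add: field_simps power2_eq_square power3_eq_cube)
    ultimately show ?thesis by linarith
  qed
  finally have "exp (4 * \<delta> * real n - real k) / (2 * s) \<le> \<sigma> * \<delta>\<^sup>2 / 8 / (2 * s)"
    using \<sigma> \<delta> by (intro divide_right_mono) (auto simp: s_eq)
  also have "\<dots> = \<delta> / 16" using \<sigma> \<delta> by (simp add: s_eq power2_eq_square)
  finally have 1: "exp (4 * \<delta> * real n - real k) / (2 * s) \<le> \<delta> / 16" .
  have "\<sigma> * \<delta>\<^sup>2 \<le> 1 / 48 * 1"
    using \<sigma> \<delta> by (intro mult_mono) (auto simp: power_le_one)
  then have "\<delta> * (\<sigma> * \<delta>\<^sup>2) \<le> \<delta> * (1 / 48)" using \<delta> by (intro mult_left_mono) auto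
  then have 2: "3 * s / 2 * \<delta>\<^sup>2 \<le> \<delta> / 32" by (simp add: s_eq mult_ac)
  have "\<kappa> \<le> C" using C n1 by (simp add: \<kappa>_def field_simps)
  then have "6 * s * \<kappa> \<le> 6 * s * C" using \<sigma> \<delta> by (intro mult_left_mono) (auto simp: s_eq)
  also have "\<dots> = \<delta> * (6 * \<sigma> * C)" by (simp add: s_eq)
  also have "\<dots> \<le> \<delta> * (1/8)" using \<sigma> \<delta> by (intro mult_left_mono) auto
  finally have 3: "4 * (3 * s / 2) * \<kappa> \<le> \<delta> / 8" by simp
  have 4: "\<eta> / 128 = \<delta> / 4" by (simp add: \<delta>_def)
  show ?thesis
    unfolding k_def[symmetric] using 1 2 3 4 \<delta> by linarith
qed

theorem theorem3p4:
  fixes C_MSE :: real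
  assumes "C_MSE > 0"
  shows "\<exists>C_high > 0. \<exists>c_high > 0. \<exists>N0 :: nat.
    \<forall>d n f \<eta>. d \<ge> 1 \<longrightarrow> n \<ge> N0 \<longrightarrow> meas_estimator d n f \<longrightarrow> mse_accurate C_MSE d n f \<longrightarrow>
      0 < \<eta> \<longrightarrow> \<eta> < 1/10 \<longrightarrow> real (nat \<lfloor>\<eta> * real n\<rfloor>) \<ge> C_high * ln (real n) \<longrightarrow>
      (SUP \<mu> \<in> vecs d. ES2 d n f \<eta> \<mu>) \<ge> ennreal (c_high * \<eta>)"
proof -
  define C where "C = C_MSE"
  have C: "C > 0" using assms by (simp add: C_def)
  \<comment> \<open>The constant 1/128 is a quarter of the step \<open>\<eta> / 32\<close>; the
    factor 4 before the logarithm and the threshold for \<open>n\<close> are those of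
    \<open>parameter_bounds\<close>.\<close>
  have "ennreal (1/128 * \<eta>) \<le> (SUP \<mu> \<in> vecs d. ES2 d n f \<eta> \<mu>)"
    if d: "d \<ge> 1" and n: "n \<ge> nat \<lceil>393216 * (C + 1)\<rceil>"
      and f: "meas_estimator d n f" and acc: "mse_accurate C d n f"
      and \<eta>: "0 < \<eta>" "\<eta> < 1/10" and k: "real (nat \<lfloor>\<eta> * real n\<rfloor>) \<ge> 4 * ln (real n)"
    for d n f \<eta>
  proof (rule ccontr)
    assume "\<not> ?thesis"
    then have small: "ES2 d n f \<eta> \<mu> < ennreal (\<eta> / 128)" if "\<mu> \<in> vecs d" for \<mu>
      using SUP_upper[OF that, of "ES2 d n f \<eta>"] by (simp add: not_le)
    define \<delta> \<kappa> s where "\<delta> = \<eta> / 32" and "\<kappa> = C / real n" and "s = \<eta> / 32 / (48 * (C + 1))"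
    have n': "real n \<ge> 393216 * (C + 1)" using n by linarith
    moreover have "393216 * (C + 1) > 0" using C by simp
    ultimately have n0: "real n > 0" by linarith
    have \<delta>: "0 < \<delta>" "\<delta> \<le> 1" and \<kappa>: "\<kappa> > 0" and s: "s > 0"
      using \<eta> C n0 by (simp_all add: \<delta>_def \<kappa>_def s_def)
    \<comment> \<open>Half the number of grid points per axis, just large enough that a drift of
      \<open>\<delta> / 2\<close> per step exceeds \<open>2 * sqrt \<kappa>\<close> after
      \<open>M\<close> steps.\<close>
    define M where "M = nat \<lceil>4 * sqrt \<kappa> / \<delta>\<rceil> + 1"
    have M: "M > 0" "real M > 4 * sqrt \<kappa> / \<delta>" unfolding M_def by linarith+
    define mean where "mean a = (\<lambda>i\<in>{..<d}. \<delta> * real (a i))" for a :: "nat \<Rightarrow> nat"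
    have mean: "mean a \<in> vecs d" for a by (simp add: mean_def vecs_def)
    define e where "e j a = (\<integral>X. (f X j - mean a j)\<^sup>2 \<partial>gauss_data d n (mean a))" for j a
    note mse = coord_mse[OF f acc less_imp_le[OF C] mean]
    have "(\<Sum>j<d. e j a) \<le> real d * \<kappa>" for a
      using mse(2)[of a] by (simp add: e_def \<kappa>_def mult_ac)
    \<comment> \<open>The bound \<kappa> for the average error on this line in coordinate
      \<open>j\<close> is free of \<open>d\<close>. Entry \<open>j\<close> of \<open>a\<close> is
      overwritten along the line.\<close>
    then obtain j a where j: "j < d" and line: "(\<Sum>l<2 * M. e j (a(j := l))) \<le> real (2 * M) * \<kappa>"
      using ex_good_line[of "2 * M" d e \<kappa>] M d by (metis One_nat_def Suc_le_eq nat_0_less_mult_iff zero_less_numeral)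
    \<comment> \<open>The means on the good line; \<open>h\<close> is the bias of coordinate
      \<open>j\<close> there.\<close>
    define m where "m l = mean (a(j := l))" for l
    define h where "h l = (\<integral>X. f X j \<partial>gauss_data d n (m l)) - m l j" for l
    have m_Suc: "m (Suc l) = (m l)(j := m l j + \<delta>)" for l
      using j by (auto simp: m_def mean_def fun_eq_iff algebra_simps)
    \<comment> \<open>The mean advances by \<delta> while the expectation gains at most the bracket
      plus errors, so the bias falls by at least \<open>A\<close> up to errors.\<close>
    define A where "A = \<delta> - (\<eta> / 128 + exp (4 * \<delta> * real n - real (nat \<lfloor>\<eta> * real n\<rfloor>)) / (2 * s)
      + 3 * s / 2 * \<delta>\<^sup>2)"
    have "real M * (A - 4 * (3 * s / 2) * \<kappa>) \<le> 2 * sqrt \<kappa>"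
    proof (rule drift_bound[where h = h and e = "\<lambda>l. e j (a(j := l))"])
      fix l
      show "(h l)\<^sup>2 \<le> e j (a(j := l))"
        unfolding h_def m_def e_def by (intro coord_bias f j mse(1))
      interpret mean_shift d n j \<delta> "m l" by unfold_locales (use j \<delta> in auto)
      have int: "integrable (gauss_data d n (m l)) (\<lambda>X. (f X j - m l j)\<^sup>2)" for l
        unfolding m_def by (rule mse(1)[OF j])
      have "(\<integral>\<^sup>+ X. (sens d n f \<eta> X)\<^sup>2 \<partial>gauss_data d n (m l)) \<le> ennreal ((\<eta> / 128)\<^sup>2)"
        using \<eta> by (intro ES2_less_imp small) (simp_all add: m_def mean)
      then have "(\<integral>X. f X j \<partial>gauss_data d n (m (Suc l))) - (\<integral>X. f X j \<partial>gauss_data d n (m l))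
        \<le> \<eta> / 128 + exp (4 * \<delta> * real n - real (nat \<lfloor>\<eta> * real n\<rfloor>)) / (2 * s)
          + 3 * s / 2 * (e j (a(j := l)) + e j (a(j := Suc l)) + \<delta>\<^sup>2)"
        using mean_step[OF f _ _ _ _ s, of \<eta> "\<eta> / 128", folded m_Suc] int \<eta>
        unfolding e_def m_def[symmetric] by simp
      moreover have "m (Suc l) j = m l j + \<delta>" by (simp add: m_Suc)
      ultimately show "h (Suc l) - h l \<le> - A + 3 * s / 2 * (e j (a(j := l)) + e j (a(j := Suc l)))"
        unfolding h_def A_def by (simp add: algebra_simps)
    qed (use M \<kappa> s line in auto)
    moreover have "\<delta> / 2 \<le> A - 4 * (3 * s / 2) * \<kappa>"
      using parameter_bounds[OF C \<eta> n' k] unfolding A_def \<delta>_def \<kappa>_def s_def .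
    then have "real M * (\<delta> / 2) \<le> real M * (A - 4 * (3 * s / 2) * \<kappa>)"
      by (intro mult_left_mono) auto
    \<comment> \<open>The accumulated drift is now larger than the average error on the line
      permits.\<close>
    moreover have "real M * (\<delta> / 2) > 2 * sqrt \<kappa>"
      using M(2) \<delta> by (simp add: field_simps)
    ultimately show False by linarith
  qed
  then show ?thesis
    unfolding C_def
    by (intro exI[of _ 4] exI[of _ "1/128"] exI[of _ "nat \<lceil>393216 * (C_MSE + 1)\<rceil>"] conjI) auto
qed

end
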